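(* Let $f^L\le f^U$ in $\mathbb{R}^d$ and let $\phi:[f^L,f^U]\to\mathbb{R}$ be supermodular. Then for every permutation $\omega=(\omega_1,\dots,\omega_d)$ of $\{1,\dots,d\}$, the function of $f\in[f^L,f^U]$ $$\phi(f^L)+\sum_{i=1}^d\Biggl[\phi\Bigl(\sum_{j=1}^{i-1}e_{\omega_j}f^U_{\omega_j}+e_{\omega_i}f_{\omega_i}+\sum_{j=i+1}^d e_{\omega_j}f^L_{\omega_j}\Bigr)-\phi\Bigl(\sum_{j=1}^{i-1}e_{\omega_j}f^U_{\omega_j}+\sum_{j=i}^d e_{\omega_j}f^L_{\omega_j}\Bigr)\Biggr]$$ is an overestimator of $\phi$ over $[f^L,f^U]$ (i.e. it is $\ge\phi(f)$ at every $f\in[f^L,f^U]$). If moreover $\phi$ is concave in each argument when the others are fixed, then this function is concave.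
   Context: $[f^L,f^U]=\prod_{i=1}^d[f^L_i,f^U_i]$, and $e_i$ is the $i$-th unit vector of $\mathbb{R}^d$. $\phi$ is supermodular if $\phi(x'\vee x'')+\phi(x'\wedge x'')\ge\phi(x')+\phi(x'')$ for all $x',x''$ in the box, with $\vee,\wedge$ the componentwise maximum and minimum. *)

theory Defs
  imports "HOL-Analysis.Analysis"
begin

text \<open>On \<^typ>\<open>real ^ 'n\<close> the order, \<^const>\<open>sup\<close> and \<^const>\<open>inf\<close> are componentwise.\<close>

definition supermodular_on :: "(real ^ 'n) set \<Rightarrow> (real ^ 'n \<Rightarrow> real) \<Rightarrow> bool" where
  "supermodular_on S \<phi> \<longleftrightarrow>
     (\<forall>x'\<in>S. \<forall>x''\<in>S. \<phi> (sup x' x'') + \<phi> (inf x' x'') \<ge> \<phi> x' + \<phi> x'')"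

definition argumentwise_concave_on_box ::
    "real ^ 'n \<Rightarrow> real ^ 'n \<Rightarrow> (real ^ 'n \<Rightarrow> real) \<Rightarrow> bool" where
  "argumentwise_concave_on_box fL fU \<phi> \<longleftrightarrow>
     (\<forall>x\<in>{fL..fU}. \<forall>k. concave_on {fL $ k..fU $ k} (\<lambda>t. \<phi> (\<chi> m. if m = k then t else x $ m)))"

text \<open>The coordinates are indexed by the type \<^typ>\<open>'n\<close> rather than by $1,\dots,d$; accordingly a
  permutation is a bijection \<open>\<omega>\<close> from \<open>{1..CARD('n)}\<close> onto \<^typ>\<open>'n\<close>, only its values
  on \<open>{1..CARD('n)}\<close> being used.\<close>

definition staircase_overestimator ::
    "real ^ 'n \<Rightarrow> real ^ 'n \<Rightarrow> (real ^ 'n \<Rightarrow> real) \<Rightarrow> (nat \<Rightarrow> 'n) \<Rightarrow> real ^ 'n \<Rightarrow> real" where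
  "staircase_overestimator fL fU \<phi> \<omega> f =
     \<phi> fL + (\<Sum>i = 1..CARD('n).
        \<phi> ((\<Sum>j = 1..i - 1. (fU $ \<omega> j) *\<^sub>R axis (\<omega> j) 1) + (f $ \<omega> i) *\<^sub>R axis (\<omega> i) 1
             + (\<Sum>j = i + 1..CARD('n). (fL $ \<omega> j) *\<^sub>R axis (\<omega> j) 1))
      - \<phi> ((\<Sum>j = 1..i - 1. (fU $ \<omega> j) *\<^sub>R axis (\<omega> j) 1)
             + (\<Sum>j = i..CARD('n). (fL $ \<omega> j) *\<^sub>R axis (\<omega> j) 1)))"

end

(* The overestimator is a sum of increments along the staircase path from fL to fU in the order
   omega. Raise the coordinates of fL to those of f in the same order: the i-th increment of phi
   along this lower path is at most the i-th term of the sum, because supermodularity says that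
   the effect of raising coordinate omega i grows when the earlier coordinates are raised from
   f to fU. The lower increments telescope to phi f - phi fL. *)

theory Submission
  imports Defs
begin

text \<open>Both staircase paths are instances: \<open>x = fU\<close> gives the base points of the
  overestimator, \<open>x = f\<close> the lower path ending at \<open>f\<close>. For
  \<open>i = 0\<close> the index set is empty and the point is \<open>l\<close>.\<close>

definition partial_raise :: "real ^ 'n \<Rightarrow> real ^ 'n \<Rightarrow> (nat \<Rightarrow> 'n) \<Rightarrow> nat \<Rightarrow> real ^ 'n" where
  "partial_raise l x \<omega> i = (\<chi> k. if k \<in> \<omega> ` {1..i} then x $ k else l $ k)"

lemma sum_axis_nth:
  fixes x :: "real ^ 'n" and \<omega> :: "nat \<Rightarrow> 'n"
  assumes "inj_on \<omega> A" "finite A"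
  shows "(\<Sum>j\<in>A. (x $ \<omega> j) *\<^sub>R axis (\<omega> j) 1) $ k = (if k \<in> \<omega> ` A then x $ k else 0)"
proof -
  have reindex: "(\<Sum>j\<in>A. (x $ \<omega> j) *\<^sub>R axis (\<omega> j) 1) = (\<Sum>m\<in>\<omega> ` A. (x $ m) *\<^sub>R axis m (1::real))"
    using assms(1) by (simp add: sum.reindex)
  have "(\<Sum>j\<in>A. (x $ \<omega> j) *\<^sub>R axis (\<omega> j) 1) $ k = (\<Sum>m\<in>\<omega> ` A. if m = k then x $ m else 0)"
    unfolding reindex by (subst sum_component, rule sum.cong) (auto simp: axis_def)
  then show ?thesis
    using assms(2) by (simp add: sum.delta)
qed

text \<open>By bijectivity \<open>k = \<omega> j\<close> for exactly one \<open>j\<close>, and the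
  cases are \<open>j < i\<close>, \<open>j = i\<close> and \<open>j > i\<close>. Each fixes the
  truth value of every membership test in the componentwise identities below, which then reduce to
  rewriting.\<close>

lemma staircase_cases:
  fixes \<omega> :: "nat \<Rightarrow> 'a"
  assumes \<omega>: "bij_betw \<omega> {1..n} UNIV" and i: "i \<in> {1..n}"
  obtains (before) "k \<in> \<omega> ` {1..i - 1}" "k \<noteq> \<omega> i" "k \<notin> \<omega> ` {i + 1..n}" "k \<in> \<omega> ` {1..i}" "k \<notin> \<omega> ` {i..n}"
    | (at) "k \<notin> \<omega> ` {1..i - 1}" "k = \<omega> i" "k \<notin> \<omega> ` {i + 1..n}" "k \<in> \<omega> ` {1..i}" "k \<in> \<omega> ` {i..n}"
    | (after) "k \<notin> \<omega> ` {1..i - 1}" "k \<noteq> \<omega> i" "k \<in> \<omega> ` {i + 1..n}" "k \<notin> \<omega> ` {1..i}" "k \<in> \<omega> ` {i..n}"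
proof -
  obtain j where j: "j \<in> {1..n}" "k = \<omega> j"
    using \<omega> by (metis UNIV_I bij_betw_imp_surj_on imageE)
  \<comment> \<open>The bounds keep \<open>{a..b}\<close> inside \<open>{1..n}\<close>, where
    \<open>\<omega>\<close> is injective.\<close>
  have mem: "k \<in> \<omega> ` {a..b} \<longleftrightarrow> a \<le> j \<and> j \<le> b" if "1 \<le> a" "b \<le> n" for a b
    using that j \<omega> inj_on_image_mem_iff[OF bij_betw_imp_inj_on[OF \<omega>], of j "{a..b}"] by auto
  have eq: "k = \<omega> i \<longleftrightarrow> j = i"
    using j i \<omega> by (metis bij_betw_imp_inj_on inj_on_eq_iff)
  have "k \<in> \<omega> ` {1..i - 1} \<longleftrightarrow> j < i" "k \<in> \<omega> ` {i + 1..n} \<longleftrightarrow> i < j"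
    "k \<in> \<omega> ` {1..i} \<longleftrightarrow> j \<le> i" "k \<in> \<omega> ` {i..n} \<longleftrightarrow> i \<le> j"
    using i j(1) by (subst mem; auto)+
  then show thesis
    using eq that by (cases j i rule: linorder_cases) auto
qed

text \<open>The axes in each vector sum are distinct and exhaust the coordinates, so every component
  receives exactly one summand. In the resulting form \<open>f\<close> enters a term only through
  coordinate \<open>\<omega> i\<close> of a fixed path point.\<close>

lemma staircase_overestimator_eq:
  fixes fL fU :: "real ^ 'n" and \<omega> :: "nat \<Rightarrow> 'n"
  assumes \<omega>: "bij_betw \<omega> {1..CARD('n)} UNIV"
  shows "staircase_overestimator fL fU \<phi> \<omega> f = \<phi> fL + (\<Sum>i = 1..CARD('n).
      \<phi> (\<chi> m. if m = \<omega> i then f $ m else partial_raise fL fU \<omega> (i - 1) $ m)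
      - \<phi> (partial_raise fL fU \<omega> (i - 1)))"
proof -
  have inj: "inj_on \<omega> B" if "B \<subseteq> {1..CARD('n)}" for B
    using \<omega> that bij_betw_imp_inj_on inj_on_subset by blast
  have "(\<Sum>j = 1..i - 1. (fU $ \<omega> j) *\<^sub>R axis (\<omega> j) 1) + (f $ \<omega> i) *\<^sub>R axis (\<omega> i) 1
          + (\<Sum>j = i + 1..CARD('n). (fL $ \<omega> j) *\<^sub>R axis (\<omega> j) 1)
        = (\<chi> m. if m = \<omega> i then f $ m else partial_raise fL fU \<omega> (i - 1) $ m)" (is "?A = ?A'")
    and "(\<Sum>j = 1..i - 1. (fU $ \<omega> j) *\<^sub>R axis (\<omega> j) 1)
          + (\<Sum>j = i..CARD('n). (fL $ \<omega> j) *\<^sub>R axis (\<omega> j) 1)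
        = partial_raise fL fU \<omega> (i - 1)" (is "?B = ?B'")
    if i: "i \<in> {1..CARD('n)}" for i
  proof -
    have inj': "inj_on \<omega> {1..i - 1}" "inj_on \<omega> {i + 1..CARD('n)}" "inj_on \<omega> {i..CARD('n)}"
      using i by (auto intro!: inj)
    have axis: "axis (\<omega> i) (1::real) $ k = (if k = \<omega> i then 1 else 0)" for k
      by (simp add: axis_def)
    have "?A $ k = ?A' $ k \<and> ?B $ k = ?B' $ k" for k
      by (cases rule: staircase_cases[OF \<omega> i, of k])
        (simp_all only: vector_add_component vector_scaleR_component sum_axis_nth inj'
          finite_atLeastAtMost partial_raise_def vec_lambda_beta axis if_True if_False simp_thms, auto)
    then show "?A = ?A'" "?B = ?B'"
      by (simp_all only: vec_eq_iff, blast+)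
  qed
  then show ?thesis
    unfolding staircase_overestimator_def by (simp only: cong: sum.cong)
qed

text \<open>The projection to coordinate \<open>k\<close> is linear and maps the box into the
  interval, so concavity survives composition.\<close>

lemma concave_on_box_component:
  fixes l u :: "real ^ 'n"
  assumes "concave_on {l $ k..u $ k} g"
  shows "concave_on {l..u} (\<lambda>f. g (f $ k))"
  unfolding concave_on_iff
proof (intro conjI ballI allI impI)
  show "convex {l..u}"
    by (simp flip: interval_cbox)
next
  fix x y and a b :: real
  assume "x \<in> {l..u}" "y \<in> {l..u}" "a \<ge> 0" "b \<ge> 0" "a + b = 1"
  then show "g ((a *\<^sub>R x + b *\<^sub>R y) $ k) \<ge> a * g (x $ k) + b * g (y $ k)"
    using assms by (auto simp: concave_on_iff less_eq_vec_def)
qed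

lemma concave_on_sum_functions:
  assumes "finite I" "convex S" "\<And>i. i \<in> I \<Longrightarrow> concave_on S (g i)"
  shows "concave_on S (\<lambda>x. \<Sum>i\<in>I. g i x)"
  using assms
  by (induction I rule: finite_induct) (auto intro!: concave_on_add simp: concave_on_const)

theorem proposition2p1:
  fixes fL fU :: "real ^ 'n" and \<phi> :: "real ^ 'n \<Rightarrow> real"
  assumes "fL \<le> fU"
    and "supermodular_on {fL..fU} \<phi>"
  shows "\<forall>\<omega>. bij_betw \<omega> {1..CARD('n)} (UNIV :: 'n set) \<longrightarrow>
           (\<forall>f\<in>{fL..fU}. staircase_overestimator fL fU \<phi> \<omega> f \<ge> \<phi> f) \<and>
           (argumentwise_concave_on_box fL fU \<phi> \<longrightarrow>
              concave_on {fL..fU} (staircase_overestimator fL fU \<phi> \<omega>))"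
proof (intro allI impI conjI ballI)
  fix \<omega> :: "nat \<Rightarrow> 'n" and f
  assume \<omega>: "bij_betw \<omega> {1..CARD('n)} (UNIV :: 'n set)" and f: "f \<in> {fL..fU}"
  let ?M = "partial_raise fL f \<omega>" and ?U = "partial_raise fL fU \<omega>"
  let ?S = "\<lambda>i. \<chi> m. if m = \<omega> i then f $ m else ?U (i - 1) $ m"
  have le: "fL $ k \<le> f $ k" "f $ k \<le> fU $ k" for k
    using f by (auto simp: less_eq_vec_def)
  have step: "\<phi> (?M i) - \<phi> (?M (i - 1)) \<le> \<phi> (?S i) - \<phi> (?U (i - 1))"
    if i: "i \<in> {1..CARD('n)}" for i
  proof -
    \<comment> \<open>Before position \<open>i\<close> the two points carry \<open>fU\<close> and
      \<open>f\<close>, at \<open>i\<close> they carry \<open>fL\<close> and \<open>f\<close>, and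
      after it both carry \<open>fL\<close>. Supermodularity at this pair is the claimed inequality,
      rearranged.\<close>
    have "sup (?U (i - 1)) (?M i) $ k = ?S i $ k \<and> inf (?U (i - 1)) (?M i) $ k = ?M (i - 1) $ k" for k
      by (cases rule: staircase_cases[OF \<omega> i, of k])
        (use le[of k] in \<open>simp_all only: partial_raise_def sup_vec_def inf_vec_def vec_lambda_beta
          if_True if_False simp_thms sup_real_def inf_real_def max_def min_def, auto\<close>)
    then have "sup (?U (i - 1)) (?M i) = ?S i" "inf (?U (i - 1)) (?M i) = ?M (i - 1)"
      by (simp_all only: vec_eq_iff, blast+)
    moreover have "?U (i - 1) \<in> {fL..fU}" "?M i \<in> {fL..fU}"
      using le order_trans[OF le] by (auto simp: partial_raise_def less_eq_vec_def)
    ultimately show ?thesis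
      using assms(2) unfolding supermodular_on_def by (smt (verit))
  qed
  \<comment> \<open>These are the ends of the telescoping sum; the second uses surjectivity of
    \<open>\<omega>\<close>.\<close>
  have "?M 0 = fL" "?M CARD('n) = f"
    using bij_betw_imp_surj_on[OF \<omega>] by (auto simp: partial_raise_def)
  then have "\<phi> f = \<phi> fL + (\<Sum>i = 1..CARD('n). \<phi> (?M i) - \<phi> (?M (i - 1)))"
    using sum_telescope''[of 0 "CARD('n)" "\<lambda>i. \<phi> (?M i)"]
    by simp
  also have "\<dots> \<le> \<phi> fL + (\<Sum>i = 1..CARD('n). \<phi> (?S i) - \<phi> (?U (i - 1)))"
    by (intro add_left_mono sum_mono step)
  also have "\<dots> = staircase_overestimator fL fU \<phi> \<omega> f"
    by (rule staircase_overestimator_eq[OF \<omega>, symmetric])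
  finally show "staircase_overestimator fL fU \<phi> \<omega> f \<ge> \<phi> f" .
next
  fix \<omega> :: "nat \<Rightarrow> 'n"
  assume \<omega>: "bij_betw \<omega> {1..CARD('n)} (UNIV :: 'n set)"
    and conc: "argumentwise_concave_on_box fL fU \<phi>"
  let ?U = "partial_raise fL fU \<omega>"
  have cvx: "convex {fL..fU}"
    by (simp flip: interval_cbox)
  \<comment> \<open>Argumentwise concavity is applied at the base point \<open>?U (i - 1)\<close>,
    which lies in the box because \<open>fL \<le> fU\<close>.\<close>
  have "concave_on {fL..fU} (\<lambda>f. \<phi> (\<chi> m. if m = \<omega> i then f $ m else ?U (i - 1) $ m))" for i
  proof -
    have "?U (i - 1) \<in> {fL..fU}"
      using assms(1) by (auto simp: partial_raise_def less_eq_vec_def)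
    then have "concave_on {fL $ \<omega> i..fU $ \<omega> i} (\<lambda>t. \<phi> (\<chi> m. if m = \<omega> i then t else ?U (i - 1) $ m))"
      using conc unfolding argumentwise_concave_on_box_def by blast
    from concave_on_box_component[OF this] show ?thesis
      by (simp cong: if_cong)
  qed
  then show "concave_on {fL..fU} (staircase_overestimator fL fU \<phi> \<omega>)"
    \<comment> \<open>The subtracted values do not depend on \<open>f\<close>; written as added
      negatives they are constants, hence concave.\<close>
    unfolding staircase_overestimator_eq[OF \<omega>] diff_conv_add_uminus
    by (intro concave_on_add concave_on_sum_functions) (auto simp: concave_on_const cvx)
qed

end
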